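(* Let $\nu>-1/2$, and let $\{P_n\}_{n\ge0}$ be the sequence of polynomials orthonormal with respect to the weight $\rho_\nu^2$ on $(0,\infty)$, i.e. $\deg P_n=n$ and $\int_0^\infty P_m(x)P_n(x)\rho_\nu^2(x)\,dx=\delta_{n,m}$. Then $\{P_n\}_{n\ge0}$ is compositionally orthogonal in the sense of Laguerre relatively to the function $t^\nu e^t\Gamma(-\nu,t)$, i.e. for all $n,m\in\mathbb{N}_0$ $$\int_0^\infty t^\nu e^{-t}\,P_n(\theta)P_m(\theta)\left(t^\nu e^t\Gamma(-\nu,t)\right)dt=\frac{\delta_{n,m}}{\Gamma(1+\nu)} .$$
   Context: $\theta=tDt$ with $D=d/dt$, i.e. $\theta\{f\}(t)=t\frac{d}{dt}\big(tf(t)\big)$; for a polynomial $P(x)=\sum_kp_kx^k$, $P(\theta)=\sum_kp_k\theta^k$. For $x>0$, $\rho_\nu(x)=2x^{\nu/2}K_\nu(2\sqrt x)=\int_0^\infty t^{\nu-1}e^{-t-x/t}\,dt$, where $K_\nu$ is the Macdonald function (modified Bessel function of the second kind). $\Gamma(a,z)=\int_z^\infty e^{-u}u^{a-1}\,du$ is the incomplete gamma function. $\delta_{n,m}$ is the Kronecker symbol. *)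

theory Defs
  imports "HOL-Analysis.Analysis"
begin

(* Modified Bessel function of the second kind, by the integral representation that is
   valid for z > 0 and every real \<nu>. *)
definition macdonald_K :: "real \<Rightarrow> real \<Rightarrow> real" where
  "macdonald_K \<nu> z = (LBINT u:{0<..}. exp (- z * cosh u) * cosh (\<nu> * u))"

definition rho :: "real \<Rightarrow> real \<Rightarrow> real" where
  "rho \<nu> x = 2 * x powr (\<nu> / 2) * macdonald_K \<nu> (2 * sqrt x)"

definition upper_Gamma :: "real \<Rightarrow> real \<Rightarrow> real" where
  "upper_Gamma a z = (LBINT u:{z<..}. exp (- u) * u powr (a - 1))"

definition omega :: "real \<Rightarrow> real \<Rightarrow> real" where
  "omega \<nu> t = t powr \<nu> * exp t * upper_Gamma (- \<nu>) t"

(* The operator t D t, for f differentiable at t. *)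
definition theta :: "(real \<Rightarrow> real) \<Rightarrow> real \<Rightarrow> real" where
  "theta f t = t * deriv (\<lambda>s. s * f s) t"

definition poly_theta :: "real poly \<Rightarrow> (real \<Rightarrow> real) \<Rightarrow> real \<Rightarrow> real" where
  "poly_theta P f t = (\<Sum>k\<le>degree P. coeff P k * (theta ^^ k) f t)"

lemma cosh_ge_half_square:
  fixes u :: real
  assumes "u \<ge> 0"
  shows "cosh u \<ge> u\<^sup>2 / 4"
proof -
  have "exp u \<ge> 1 + u + u\<^sup>2 / 2"
    by (rule exp_lower_Taylor_quadratic[OF assms])
  then have "exp u \<ge> u\<^sup>2 / 2"
    using assms by linarith
  moreover have "exp (- u) > 0" by simp
  ultimately show ?thesis
    unfolding cosh_field_def by argo
qed

lemma set_integrable_macdonald_aux: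
  fixes \<nu> z :: real
  assumes "z > 0"
  shows "set_integrable lborel {0<..} (\<lambda>u. exp (\<nu> * u) * exp (- z * cosh u))"
proof -
  define C where "C = (\<nu> + 1)\<^sup>2 / z"
  have "(\<lambda>u::real. exp (- 1 * u)) absolutely_integrable_on {0..}"
    by (intro nonnegative_absolutely_integrable_1 integrable_on_exp_minus_to_infinity) auto
  then have "set_integrable lborel {0..} (\<lambda>u::real. exp (- 1 * u))"
    unfolding set_integrable_def
    by (rule integrable_completion[THEN iffD1, rotated]) measurable
  then have "set_integrable lborel {0<..} (\<lambda>u::real. exp (- 1 * u))"
    by (rule set_integrable_subset) auto
  then have "set_integrable lborel {0<..} (\<lambda>u::real. exp C * exp (- 1 * u))"
    by (rule set_integrable_mult_right)
  then show ?thesis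
  proof (rule set_integrable_bound)
    show "set_borel_measurable lborel {0<..} (\<lambda>u. exp (\<nu> * u) * exp (- z * cosh u))"
      unfolding set_borel_measurable_def cosh_def by measurable
    have "\<nu> * u - z * cosh u \<le> C - u" if "u > 0" for u :: real
    proof -
      have "z * (u\<^sup>2 / 4) \<le> z * cosh u"
        using cosh_ge_half_square[of u] that assms by (intro mult_left_mono) auto
      moreover have "0 \<le> z * (u / 2 - (\<nu> + 1) / z)\<^sup>2"
        using assms by simp
      moreover have "z * (u / 2 - (\<nu> + 1) / z)\<^sup>2 = z * (u\<^sup>2 / 4) - (\<nu> + 1) * u + C"
        using assms by (simp add: C_def field_simps power2_eq_square)
      ultimately show ?thesis by (simp add: algebra_simps)
    qed
    then show "AE u in lborel. u \<in> {0<..} \<longrightarrow>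
        norm (exp (\<nu> * u) * exp (- z * cosh u)) \<le> norm (exp C * exp (- 1 * u))"
      by (auto simp flip: exp_add)
  qed
qed

lemma macdonald_K_whole_line:
  fixes \<nu> z :: real
  assumes z: "z > 0"
  defines "h \<equiv> \<lambda>u. exp (\<nu> * u) * exp (- z * cosh u)"
  shows "set_integrable lborel UNIV h"
    and "(LBINT u=-\<infinity>..\<infinity>. h u) = 2 * macdonald_K \<nu> z"
proof -
  have p: "set_integrable lborel {0<..} h"
    unfolding h_def by (rule set_integrable_macdonald_aux[OF z])
  have m: "set_integrable lborel {0<..} (\<lambda>u. h (-u))"
    using set_integrable_macdonald_aux[OF z, of "-\<nu>"] by (simp add: h_def)
  have n: "set_integrable lborel {..<0} h"
  proof -
    have "integrable lborel (\<lambda>u. indicator {0<..} (0 + (-1) * u) *\<^sub>R h (- (0 + (-1) * u)))"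
      using m unfolding set_integrable_def by (rule lborel_integrable_real_affine) auto
    then show ?thesis
      unfolding set_integrable_def
      by (rule back_subst[where P="integrable lborel"]) (auto simp: fun_eq_iff indicator_def)
  qed
  have "continuous_on {-1..1} h"
    unfolding h_def cosh_field_def by (intro continuous_intros) auto
  then have z: "set_integrable lborel {-1..1} h"
    by (rule borel_integrable_atLeastAtMost')
  have "set_integrable lborel ({..<0} \<union> {0<..} \<union> {-1..1}) h"
    by (intro set_integrable_Un n p z) simp_all
  moreover have "{..<0} \<union> {0<..} \<union> {-1..1} = (UNIV :: real set)" by auto
  ultimately show U: "set_integrable lborel UNIV h" by simp
  have "(LBINT u=-\<infinity>..\<infinity>. h u) = (LBINT u=-\<infinity>..0. h u) + (LBINT u=0..\<infinity>. h u)"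
    by (rule interval_integral_sum[symmetric])
      (use U in \<open>simp add: min_def max_def interval_lebesgue_integrable_def\<close>)
  also have "(LBINT u=-\<infinity>..0. h u) = (LBINT u=0..\<infinity>. h (-u))"
    by (subst interval_integral_reflect) simp
  also have "(LBINT u=0..\<infinity>. h (-u)) + (LBINT u=0..\<infinity>. h u)
      = (LBINT u:{0<..}. h (-u) + h u)"
    by (simp add: interval_lebesgue_integral_0_infty set_integral_add[OF m p])
  also have "(\<lambda>u. h (-u) + h u) = (\<lambda>u. 2 * (exp (- z * cosh u) * cosh (\<nu> * u)))"
    by (auto simp: h_def fun_eq_iff cosh_def algebra_simps)
  finally show "(LBINT u=-\<infinity>..\<infinity>. h u) = 2 * macdonald_K \<nu> z"
    by (simp add: macdonald_K_def)
qed

lemma rho_integral_form: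
  fixes \<nu> x :: real
  assumes x: "x > 0"
  shows "set_integrable lborel {0<..} (\<lambda>t. t powr (\<nu> - 1) * exp (- t - x / t))"
    and "rho \<nu> x = (LBINT t:{0<..}. t powr (\<nu> - 1) * exp (- t - x / t))"
proof -
  define f where "f = (\<lambda>t. t powr (\<nu> - 1) * exp (- t - x / t))"
  define g where "g = (\<lambda>u. sqrt x * exp u)"
  define h where "h = (\<lambda>u. exp (\<nu> * u) * exp (- (2 * sqrt x) * cosh u))"
  have s: "sqrt x > 0" using x by simp
  have fg: "f (g u) * g u = x powr (\<nu> / 2) * h u" for u
  proof -
    have "g u powr (\<nu> - 1) * g u = g u powr \<nu>"
      using s by (simp add: powr_diff g_def)
    also have "\<dots> = x powr (\<nu> / 2) * exp (\<nu> * u)"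
      using x by (simp add: g_def powr_mult powr_half_sqrt[symmetric] powr_powr exp_powr_real mult.commute)
    finally have 1: "g u powr (\<nu> - 1) * g u = x powr (\<nu> / 2) * exp (\<nu> * u)" .
    have "x / g u = sqrt x * exp (-u)"
      using x s by (simp add: g_def exp_minus field_simps)
    then have 2: "- g u - x / g u = - (2 * sqrt x) * cosh u"
      by (simp add: g_def cosh_def algebra_simps)
    have "f (g u) * g u = (g u powr (\<nu> - 1) * g u) * exp (- g u - x / g u)"
      by (simp add: f_def)
    then show ?thesis unfolding 1 2 by (simp add: h_def)
  qed
  have ih: "set_integrable lborel UNIV h"
    and vh: "(LBINT u=-\<infinity>..\<infinity>. h u) = 2 * macdonald_K \<nu> (2 * sqrt x)"
    using macdonald_K_whole_line[of "2 * sqrt x" \<nu>] s by (simp_all add: h_def)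
  have gt: "g u > 0" for u using s by (simp add: g_def)
  have fc: "isCont f (g u)" for u
    unfolding f_def using gt[of u] by (intro continuous_intros) auto
  have A: "((ereal \<circ> g \<circ> real_of_ereal) \<longlongrightarrow> 0) (at_right (-\<infinity>))"
  proof -
    have "(g \<longlongrightarrow> sqrt x * 0) at_bot"
      unfolding g_def by (intro tendsto_intros exp_at_bot)
    then show ?thesis
      by (simp add: ereal_tendsto_simps zero_ereal_def)
  qed
  have B: "((ereal \<circ> g \<circ> real_of_ereal) \<longlongrightarrow> \<infinity>) (at_left \<infinity>)"
  proof -
    have "filterlim g at_top at_top"
      unfolding g_def by (rule filterlim_tendsto_pos_mult_at_top[OF tendsto_const s exp_at_top])
    then show ?thesis
      by (simp add: ereal_tendsto_simps)
  qed
  have I: "set_integrable lborel (einterval (-\<infinity>) \<infinity>) (\<lambda>u. f (g u) * g u)"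
    unfolding fg using ih by (simp add: set_integrable_mult_right)
  have S: "set_integrable lborel (einterval 0 \<infinity>) f"
    "(LBINT t=0..\<infinity>. f t) = (LBINT u=-\<infinity>..\<infinity>. f (g u) * g u)"
  proof -
    have D: "(g has_real_derivative g u) (at u)" for u
      unfolding g_def by (auto intro!: derivative_eq_intros)
    have c: "isCont g u" for u
      unfolding g_def by (intro continuous_intros)
    have nn: "0 \<le> f (g u)" for u by (simp add: f_def)
    have gn: "0 \<le> g u" for u using gt[of u] by simp
    have lt: "(-\<infinity>::ereal) < \<infinity>" by simp
    note sub = interval_integral_substitution_nonneg[OF lt D fc c nn gn A B I]
    show "set_integrable lborel (einterval 0 \<infinity>) f"
      by (rule sub(1))
    show "(LBINT t=0..\<infinity>. f t) = (LBINT u=-\<infinity>..\<infinity>. f (g u) * g u)"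
      by (rule sub(2))
  qed
  have "einterval 0 \<infinity> = {0<..}" by (auto simp: einterval_def)
  with S(1) show "set_integrable lborel {0<..} (\<lambda>t. t powr (\<nu> - 1) * exp (- t - x / t))"
    by (simp add: f_def)
  have "(LBINT t:{0<..}. f t) = (LBINT u=-\<infinity>..\<infinity>. x powr (\<nu> / 2) * h u)"
    using S(2) unfolding fg interval_lebesgue_integral_0_infty .
  also have "\<dots> = rho \<nu> x"
    by (simp add: vh rho_def)
  finally show "rho \<nu> x = (LBINT t:{0<..}. t powr (\<nu> - 1) * exp (- t - x / t))"
    by (simp add: f_def)
qed

end

theory Submission
  imports Defs
begin

text \<open>
  The function \<open>e\<^sup>-\<^sup>x\<^sup>/\<^sup>t / t\<close> is an eigenfunction of \<open>\<theta>\<close> with eigenvalue \<open>x\<close>, and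
  \<open>\<Gamma>(1+\<nu>) \<omega>(t)\<close> is the superposition of these functions with density \<open>\<rho>\<^sub>\<nu>(x)\<close>: both sides equal
  \<open>\<integral> u\<^sup>\<nu> e\<^sup>-\<^sup>u / (t+u) du\<close>. Hence \<open>P(\<theta>)\<close> multiplies the density by \<open>P(x)\<close>. Integrating against
  \<open>t\<^sup>\<nu> e\<^sup>-\<^sup>t\<close> and exchanging the integrals produces a second factor
  \<open>\<rho>\<^sub>\<nu>(x) = \<integral> t\<^sup>\<nu>\<^sup>-\<^sup>1 e\<^sup>-\<^sup>t\<^sup>-\<^sup>x\<^sup>/\<^sup>t dt\<close>.
\<close>

section \<open>Exchange of integrals, scaling and elementary integrals over half-lines\<close>

text \<open>The zero extension of \<open>f\<close> outside the rectangle is integrable on the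
  product, by Tonelli. The hypotheses concern only the order with \<open>y\<close> inside: in each
  application below that inner integral has a closed form, so integrability can be read off there
  and is carried over to the other order.\<close>

lemma set_Fubini_real:
  fixes f :: "real \<Rightarrow> real \<Rightarrow> real"
  assumes [measurable]: "case_prod f \<in> borel_measurable (lborel \<Otimes>\<^sub>M lborel)"
    "A \<in> sets lborel" "B \<in> sets lborel"
    and inner: "\<And>x. x \<in> A \<Longrightarrow> set_integrable lborel B (f x)"
    and outer: "set_integrable lborel A (\<lambda>x. LBINT y:B. \<bar>f x y\<bar>)"
  shows "set_integrable lborel B (\<lambda>y. LBINT x:A. f x y)"
    and "(LBINT y:B. (LBINT x:A. f x y)) = (LBINT x:A. (LBINT y:B. f x y))"
proof -
  define F where "F = (\<lambda>x y. indicat_real A x * (indicat_real B y * f x y))"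
  have m [measurable]: "case_prod F \<in> borel_measurable (lborel \<Otimes>\<^sub>M lborel)"
    unfolding F_def by measurable
  have "integrable lborel (\<lambda>x. LBINT y. norm (F x y))"
    using outer unfolding set_integrable_def set_lebesgue_integral_def F_def
    by (simp add: abs_mult)
  moreover have "integrable lborel (F x)" for x
    using inner[of x] unfolding set_integrable_def F_def
    by (cases "x \<in> A") auto
  ultimately have I: "integrable (lborel \<Otimes>\<^sub>M lborel) (case_prod F)"
    by (intro lborel_pair.Fubini_integrable) auto
  have 1: "(LBINT x. F x y) = indicator B y * (LBINT x:A. f x y)" for y
    unfolding set_lebesgue_integral_def F_def
    by (subst integral_mult_right_zero[symmetric]) (simp add: mult_ac)
  have 2: "(LBINT y. F x y) = indicator A x * (LBINT y:B. f x y)" for x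
    unfolding set_lebesgue_integral_def F_def by simp
  show "set_integrable lborel B (\<lambda>y. LBINT x:A. f x y)"
    using lborel_pair.integrable_snd[OF I] unfolding 1 set_integrable_def by simp
  show "(LBINT y:B. (LBINT x:A. f x y)) = (LBINT x:A. (LBINT y:B. f x y))"
    using lborel_pair.Fubini_integral[OF I] unfolding 1 2
    by (simp add: set_lebesgue_integral_def)
qed

lemma set_integral_Ioi_scale:
  fixes f :: "real \<Rightarrow> real"
  assumes "c > 0"
  shows "(LBINT x:{0<..}. f x) = c * (LBINT x:{0<..}. f (c * x))"
    and "set_integrable lborel {0<..} f \<Longrightarrow> set_integrable lborel {0<..} (\<lambda>x. f (c * x))"
proof -
  have ind: "indicator {0<..} (c * x) = (indicator {0<..} x :: real)" for x
    using assms by (simp add: indicator_def zero_less_mult_iff)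
  show "(LBINT x:{0<..}. f x) = c * (LBINT x:{0<..}. f (c * x))"
    unfolding set_lebesgue_integral_def
    using assms by (subst lborel_integral_real_affine[where c = c and t = 0]) (simp_all add: ind)
  assume "set_integrable lborel {0<..} f"
  then have "integrable lborel (\<lambda>x. indicator {0<..} x *\<^sub>R f x)"
    by (simp only: set_integrable_def)
  from lborel_integrable_real_affine[OF this, of c 0]
  show "set_integrable lborel {0<..} (\<lambda>x. f (c * x))"
    using assms by (simp add: ind set_integrable_def)
qed

text \<open>The scaling u -> c u reduces the claim to rate 1, which is Euler's integral; the
  endpoint 0 is discarded as a null set.\<close>

lemma Gamma_set_integral:
  fixes a c :: real
  assumes "a > 0" "c > 0"
  shows "set_integrable lborel {0<..} (\<lambda>u. u powr (a - 1) * exp (- (c * u)))"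
    and "(LBINT u:{0<..}. u powr (a - 1) * exp (- (c * u))) = Gamma a / c powr a"
proof -
  define g where "g = (\<lambda>u::real. u powr (a - 1) * exp (- u))"
  have "((\<lambda>t. t powr (a - 1) / exp t) has_integral Gamma a) {0..}"
    by (rule Gamma_integral_real[OF assms(1)])
  then have "((\<lambda>t. if t \<in> {0<..} then t powr (a - 1) / exp t else 0) has_integral Gamma a) {0..}"
    by (rule has_integral_spike[of "{0}", rotated 2]) auto
  then have hi: "(g has_integral Gamma a) {0<..}"
    by (subst (asm) has_integral_restrict) (auto simp: g_def exp_minus divide_inverse)
  then have "g absolutely_integrable_on {0<..}"
    by (intro nonnegative_absolutely_integrable_1) (auto simp: g_def integrable_on_def)
  then have i: "set_integrable lborel {0<..} g"
    unfolding set_integrable_def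
    by (rule integrable_completion[THEN iffD1, rotated]) (simp add: g_def)
  have v: "(LBINT u:{0<..}. g u) = Gamma a"
    using set_borel_integral_eq_integral(2)[OF i] hi by (simp add: integral_unique)
  \<comment> \<open>The factor \<open>c powr (1 - a)\<close> undoes the power of \<open>c\<close>
    that \<open>g (c * u)\<close> brings in; with the Jacobian 1/c it gives
    \<open>c powr (- a)\<close> in total.\<close>
  have e: "u powr (a - 1) * exp (- (c * u)) = c powr (1 - a) * g (c * u)" if "u > 0" for u
    using assms that by (simp add: g_def powr_mult powr_diff)
  have "set_integrable lborel {0<..} (\<lambda>u. c powr (1 - a) * g (c * u))"
    by (intro set_integrable_mult_right set_integral_Ioi_scale(2) i assms)
  then show "set_integrable lborel {0<..} (\<lambda>u. u powr (a - 1) * exp (- (c * u)))"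
    by (subst set_integrable_cong[OF refl refl e]) auto
  have "(LBINT u:{0<..}. u powr (a - 1) * exp (- (c * u))) = c powr (1 - a) * (LBINT u:{0<..}. g (c * u))"
    by (subst set_integral_mult_right[symmetric]) (rule set_lebesgue_integral_cong; simp add: e)
  also have "(LBINT u:{0<..}. g (c * u)) = Gamma a / c"
    using set_integral_Ioi_scale(1)[OF assms(2), of g] v assms by simp
  finally show "(LBINT u:{0<..}. u powr (a - 1) * exp (- (c * u))) = Gamma a / c powr a"
    using assms by (simp add: powr_diff)
qed

lemma exp_set_integral:
  fixes c t :: real
  assumes "c > 0"
  shows "set_integrable lborel {t<..} (\<lambda>x. exp (- (c * x)))"
    and "(LBINT x:{t<..}. exp (- (c * x))) = exp (- (c * t)) / c"
proof -
  have hi: "((\<lambda>x. exp (- c * x)) has_integral exp (- c * t) / c) {t..}"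
    by (rule has_integral_exp_minus_to_infinity[OF assms])
  then have "(\<lambda>x. exp (- c * x)) absolutely_integrable_on {t..}"
    by (intro nonnegative_absolutely_integrable_1) (auto simp: integrable_on_def)
  then have "set_integrable lborel {t..} (\<lambda>x. exp (- c * x))"
    unfolding set_integrable_def by (rule integrable_completion[THEN iffD1, rotated]) simp
  then have "set_integrable lborel {t<..} (\<lambda>x. exp (- c * x))"
    by (rule set_integrable_subset) auto
  then show i: "set_integrable lborel {t<..} (\<lambda>x. exp (- (c * x)))"
    by simp
  from hi have "((\<lambda>x. if x \<in> {t<..} then exp (- c * x) else 0) has_integral exp (- c * t) / c) {t..}"
    by (rule has_integral_spike[of "{t}", rotated 2]) auto
  then have "((\<lambda>x. exp (- c * x)) has_integral exp (- c * t) / c) {t<..}"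
    by (subst (asm) has_integral_restrict) auto
  then show "(LBINT x:{t<..}. exp (- (c * x))) = exp (- (c * t)) / c"
    using set_borel_integral_eq_integral(2)[OF i] by (simp add: integral_unique)
qed

section \<open>Differentiation of Laplace transforms\<close>

text \<open>Factor out the larger exponential, which is at most 1, and use 1 - exp(-y) \<le> y. This
  bounds the difference quotients of s -> exp(-xs) by x, uniformly on the half-line.\<close>

lemma exp_minus_Lipschitz:
  fixes x a b :: real
  assumes "x \<ge> 0" "a \<ge> 0" "b \<ge> 0"
  shows "\<bar>exp (- (x * a)) - exp (- (x * b))\<bar> \<le> x * \<bar>a - b\<bar>"
proof -
  have *: "\<bar>exp (- (x * a)) - exp (- (x * b))\<bar> \<le> x * (b - a)" if "a \<le> b" "a \<ge> 0" for a b
  proof -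
    have "1 - exp (- (x * (b - a))) \<le> x * (b - a)"
      using exp_ge_add_one_self[of "- (x * (b - a))"] by simp
    moreover have "0 \<le> 1 - exp (- (x * (b - a)))"
      using assms(1) that by simp
    ultimately have "exp (- (x * a)) * (1 - exp (- (x * (b - a)))) \<le> 1 * (x * (b - a))"
      using assms(1) that by (intro mult_mono) auto
    moreover have "exp (- (x * a)) * (1 - exp (- (x * (b - a)))) = exp (- (x * a)) - exp (- (x * b))"
      by (simp add: algebra_simps flip: exp_add)
    moreover have "exp (- (x * b)) \<le> exp (- (x * a))"
      using assms(1) that by (simp add: mult_left_mono)
    ultimately show ?thesis by simp
  qed
  show ?thesis
    using *[of a b] *[of b a] assms by (cases "a \<le> b") (auto simp: abs_minus_commute)
qed

lemma set_integrable_mult_exp: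
  fixes h :: "real \<Rightarrow> real"
  assumes "set_integrable lborel {0<..} h" "s \<ge> 0"
  shows "set_integrable lborel {0<..} (\<lambda>x. h x * exp (- (x * s)))"
proof (rule set_integrable_bound[OF assms(1)])
  \<comment> \<open>Integrability on the half-line gives measurability only of the truncation of
    \<open>h\<close>, so the indicator has to stay attached to \<open>h\<close>.\<close>
  have [measurable]: "(\<lambda>x. indicator {0<..} x *\<^sub>R h x) \<in> borel_measurable lborel"
    using assms(1) unfolding set_integrable_def by simp
  have "(\<lambda>x. (indicator {0<..} x *\<^sub>R h x) * exp (- (x * s))) \<in> borel_measurable lborel"
    by measurable
  then show "set_borel_measurable lborel {0<..} (\<lambda>x. h x * exp (- (x * s)))"
    by (simp add: set_borel_measurable_def mult_ac)
  show "AE x in lborel. x \<in> {0<..} \<longrightarrow> norm (h x * exp (- (x * s))) \<le> norm (h x)"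
    using assms(2) by (auto simp: abs_mult intro!: mult_left_le)
qed

text \<open>Dominated convergence applied to the difference quotients \<open>q y\<close>: by the
  Lipschitz bound they are dominated by |x h(x)|, whatever y > 0 is.\<close>

lemma has_field_derivative_Laplace:
  fixes h :: "real \<Rightarrow> real"
  assumes h: "set_integrable lborel {0<..} h"
    and xh: "set_integrable lborel {0<..} (\<lambda>x. x * h x)"
    and s: "s > 0"
  shows "((\<lambda>s. LBINT x:{0<..}. h x * exp (- (x * s)))
           has_real_derivative - (LBINT x:{0<..}. x * h x * exp (- (x * s)))) (at s)"
proof -
  define L where "L = (\<lambda>s. LBINT x:{0<..}. h x * exp (- (x * s)))"
  define D where "D = - (LBINT x:{0<..}. x * h x * exp (- (x * s)))"
  define q where "q = (\<lambda>y x. h x * ((exp (- (x * y)) - exp (- (x * s))) / (y - s)))"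
  have I: "set_integrable lborel {0<..} (\<lambda>x. h x * exp (- (x * y)))" if "y \<ge> 0" for y
    by (rule set_integrable_mult_exp[OF h that])
  have Lq: "(L y - L s) / (y - s) = (LBINT x:{0<..}. q y x)"
    and iq: "set_integrable lborel {0<..} (q y)" if y: "y > 0" for y
  proof -
    have q: "q y = (\<lambda>x. (h x * exp (- (x * y)) - h x * exp (- (x * s))) / (y - s))"
      unfolding q_def by (simp add: algebra_simps)
    show "(L y - L s) / (y - s) = (LBINT x:{0<..}. q y x)"
      unfolding q L_def using I[of y] I[of s] y s by (simp add: set_integral_diff)
    show "set_integrable lborel {0<..} (q y)"
      unfolding q using I[of y] I[of s] y s
      by (intro set_integrable_divide set_integral_diff(1)) auto
  qed
  \<comment> \<open>The limit is taken within the positive half-line, where the transform converges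
    and the Lipschitz bound applies. Since that set is open and contains \<open>s\<close>, the full
    derivative follows at the end.\<close>
  have "((\<lambda>y. LBINT x:{0<..}. q y x) \<longlongrightarrow> D) (at s within {0<..})"
    unfolding tendsto_at_iff_sequentially comp_def
  proof safe
    fix Y :: "nat \<Rightarrow> real"
    assume Y: "\<forall>i. Y i \<in> {0<..} - {s}" and lim: "Y \<longlonglongrightarrow> s"
    then have Yp: "Y i > 0" and Ys: "Y i \<noteq> s" for i by auto
    have "(\<lambda>i. LINT x|lborel. indicator {0<..} x *\<^sub>R q (Y i) x)
      \<longlonglongrightarrow> (LINT x|lborel. indicator {0<..} x *\<^sub>R - (x * h x * exp (- (x * s))))"
    proof (rule integral_dominated_convergence[where w = "\<lambda>x. \<bar>indicator {0<..} x *\<^sub>R (x * h x)\<bar>"])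
      show "(\<lambda>x. indicator {0<..} x *\<^sub>R - (x * h x * exp (- (x * s)))) \<in> borel_measurable lborel"
        using set_integrable_mult_exp[OF xh, of s] s unfolding set_integrable_def by simp
      show "(\<lambda>x. indicator {0<..} x *\<^sub>R q (Y i) x) \<in> borel_measurable lborel" for i
        using iq[OF Yp, of i] unfolding set_integrable_def by simp
      show "integrable lborel (\<lambda>x. \<bar>indicator {0<..} x *\<^sub>R (x * h x)\<bar>)"
        using xh unfolding set_integrable_def by (rule integrable_abs)
      have "(\<lambda>i. q (Y i) x) \<longlonglongrightarrow> - (x * h x * exp (- (x * s)))" for x
      proof -
        have "((\<lambda>y. exp (- (x * y))) has_real_derivative - x * exp (- (x * s))) (at s)"
          by (auto intro!: derivative_eq_intros)
        then have "((\<lambda>y. (exp (- (x * y)) - exp (- (x * s))) / (y - s)) \<longlongrightarrow> - x * exp (- (x * s))) (at s)"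
          by (simp add: has_field_derivative_iff)
        then have "(\<lambda>i. (exp (- (x * Y i)) - exp (- (x * s))) / (Y i - s)) \<longlonglongrightarrow> - x * exp (- (x * s))"
          using lim Ys unfolding tendsto_at_iff_sequentially comp_def by blast
        then have "(\<lambda>i. h x * ((exp (- (x * Y i)) - exp (- (x * s))) / (Y i - s))) \<longlonglongrightarrow> h x * (- x * exp (- (x * s)))"
          by (rule tendsto_mult_left)
        then show ?thesis by (simp add: q_def mult_ac)
      qed
      then show "AE x in lborel. (\<lambda>i. indicator {0<..} x *\<^sub>R q (Y i) x)
            \<longlonglongrightarrow> indicator {0<..} x *\<^sub>R - (x * h x * exp (- (x * s)))"
        by (intro AE_I2 tendsto_scaleR tendsto_const)
      have "\<bar>q (Y i) x\<bar> \<le> \<bar>x * h x\<bar>" if "x > 0" for i x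
      proof -
        have "\<bar>exp (- (x * Y i)) - exp (- (x * s))\<bar> / \<bar>Y i - s\<bar> \<le> x"
          using exp_minus_Lipschitz[of x "Y i" s] that Yp[of i] Ys[of i] s
          by (simp add: divide_le_eq)
        then have "\<bar>h x\<bar> * (\<bar>exp (- (x * Y i)) - exp (- (x * s))\<bar> / \<bar>Y i - s\<bar>) \<le> \<bar>h x\<bar> * x"
          by (intro mult_left_mono) auto
        then show ?thesis using that by (simp add: q_def abs_mult mult_ac)
      qed
      then show "AE x in lborel. norm (indicator {0<..} x *\<^sub>R q (Y i) x) \<le> \<bar>indicator {0<..} x *\<^sub>R (x * h x)\<bar>" for i
        by (auto simp: indicator_def)
    qed
    then show "(\<lambda>i. LBINT x:{0<..}. q (Y i) x) \<longlonglongrightarrow> D"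
      unfolding set_lebesgue_integral_def D_def by simp
  qed
  then have "((\<lambda>y. (L y - L s) / (y - s)) \<longlongrightarrow> D) (at s within {0<..})"
    by (rule Lim_transform_eventually) (auto simp: eventually_at_filter Lq)
  then have "(L has_real_derivative D) (at s within {0<..})"
    by (simp add: has_field_derivative_iff)
  then have "(L has_real_derivative D) (at s)"
    using s by (simp add: at_within_open[of s "{0<..}"])
  then show ?thesis by (simp add: L_def D_def)
qed

section \<open>Measurability, positivity and moments of the density\<close>

lemma borel_measurable_macdonald_K [measurable]: "macdonald_K \<nu> \<in> borel_measurable borel"
  unfolding macdonald_K_def set_lebesgue_integral_def cosh_field_def by measurable

lemma borel_measurable_rho [measurable]: "rho \<nu> \<in> borel_measurable borel"
  unfolding rho_def by measurable

lemma borel_measurable_poly [measurable]: "poly (p :: real poly) \<in> borel_measurable borel"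
  by (intro borel_measurable_continuous_onI continuous_intros)

lemma rho_nonneg: "x > 0 \<Longrightarrow> rho \<nu> x \<ge> 0"
  unfolding rho_integral_form(2) set_lebesgue_integral_def
  by (intro integral_nonneg_AE) auto

text \<open>Insert the integral form of \<open>rho\<close> and integrate over x first: a Gamma
  integral in x turns t^(\<nu>-1) into a multiple of t^(\<nu>+k), and t^(\<nu>+k) exp(-t) is
  integrable because \<nu> + k > -1.\<close>

lemma rho_moments:
  fixes \<nu> :: real
  assumes "\<nu> > -1"
  shows "set_integrable lborel {0<..} (\<lambda>x. x ^ k * rho \<nu> x)"
proof -
  \<comment> \<open>\<open>x ^ k\<close> is written as \<open>x powr (real (Suc k) - 1)\<close> and
    x/t as \<open>1 / t * x\<close> to match the shape of \<open>Gamma_set_integral\<close> with a =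
    k + 1 and c = 1/t.\<close>
  define f where "f = (\<lambda>t x::real. (t powr (\<nu> - 1) * exp (- t)) * (x powr (real (Suc k) - 1) * exp (- (1 / t * x))))"
  have [measurable]: "case_prod f \<in> borel_measurable (lborel \<Otimes>\<^sub>M lborel)"
    unfolding f_def by measurable
  have inner: "set_integrable lborel {0<..} (f t)" if "t \<in> {0<..}" for t
    using that unfolding f_def by (intro set_integrable_mult_right Gamma_set_integral) auto
  have "(LBINT x:{0<..}. \<bar>f t x\<bar>) = Gamma (Suc k) * (t powr (\<nu> + k + 1 - 1) * exp (- (1 * t)))"
    if "t > 0" for t
  proof -
    have "(LBINT x:{0<..}. \<bar>f t x\<bar>) = t powr (\<nu> - 1) * exp (- t) * (Gamma (Suc k) / (1 / t) powr Suc k)"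
      using that by (subst Gamma_set_integral(2)[symmetric]) (auto simp: f_def abs_mult)
    also have "1 / (1 / t) powr Suc k = t powr (k + 1)"
      using that by (simp add: powr_divide add_ac)
    then have "Gamma (Suc k) / (1 / t) powr Suc k = Gamma (Suc k) * t powr (k + 1)"
      by (metis times_divide_eq_right mult.right_neutral)
    finally show ?thesis
      using that by (simp add: powr_diff powr_add)
  qed
  moreover have "set_integrable lborel {0<..} (\<lambda>t. Gamma (Suc k) * (t powr (\<nu> + k + 1 - 1) * exp (- (1 * t))))"
    using assms by (intro set_integrable_mult_right Gamma_set_integral) auto
  ultimately have outer: "set_integrable lborel {0<..} (\<lambda>t. LBINT x:{0<..}. \<bar>f t x\<bar>)"
    by (subst set_integrable_cong[OF refl refl]) auto
  have "set_integrable lborel {0<..} (\<lambda>x. LBINT t:{0<..}. f t x)"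
    by (rule set_Fubini_real(1)[OF _ _ _ inner outer]) auto
  moreover have "(LBINT t:{0<..}. f t x) = x ^ k * rho \<nu> x" if "x > 0" for x
  proof -
    have "f t x = x ^ k * (t powr (\<nu> - 1) * exp (- t - x / t))" for t
      using that by (simp add: f_def powr_realpow exp_diff exp_minus field_simps)
    then show ?thesis using that by (simp add: rho_integral_form(2))
  qed
  ultimately show ?thesis
    by (subst (asm) set_integrable_cong[OF refl refl]) auto
qed

lemma set_integral_sum:
  fixes f :: "'i \<Rightarrow> 'a \<Rightarrow> real"
  assumes "\<And>i. i \<in> I \<Longrightarrow> set_integrable M A (f i)"
  shows "set_integrable M A (\<lambda>x. \<Sum>i\<in>I. f i x)"
    and "(LINT x:A|M. (\<Sum>i\<in>I. f i x)) = (\<Sum>i\<in>I. LINT x:A|M. f i x)"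
  using assms unfolding set_integrable_def set_lebesgue_integral_def scaleR_sum_right
  by (auto intro: Bochner_Integration.integrable_sum Bochner_Integration.integral_sum)

lemma poly_rho_integrable:
  assumes "\<nu> > -1"
  shows "set_integrable lborel {0<..} (\<lambda>x. poly Q x * rho \<nu> x)"
proof -
  have "set_integrable lborel {0<..} (\<lambda>x. \<Sum>k\<le>degree Q. coeff Q k * (x ^ k * rho \<nu> x))"
    by (intro set_integral_sum(1) set_integrable_mult_right rho_moments assms)
  then show ?thesis by (simp add: poly_altdef sum_distrib_right mult.assoc)
qed

section \<open>Polynomials in \<open>theta\<close> acting on transforms\<close>

text \<open>A superposition of the eigenfunctions exp(-x/t)/t, written as a Laplace transform at 1/t
  so that the derivative lemma and the chain rule apply. \<open>Q\<close> is a parameter because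
  \<open>theta\<close> changes nothing else.\<close>

definition rho_transform :: "real \<Rightarrow> real poly \<Rightarrow> real \<Rightarrow> real" where
  "rho_transform \<nu> Q t = (LBINT x:{0<..}. poly Q x * rho \<nu> x * exp (- (x * (1 / t)))) / t"

text \<open>Multiplication by t cancels the denominator and leaves c L(1/t). Its derivative is c M /
  t^2, and the outer factor t of \<open>theta\<close> restores the denominator t. The formula for
  \<open>f\<close> is needed on a neighbourhood of t, here the whole open half-line.\<close>

lemma theta_rho_transform:
  assumes "\<nu> > -1" "t > 0"
    and f: "\<And>s. s > 0 \<Longrightarrow> f s = c * rho_transform \<nu> Q s"
  shows "theta f t = c * rho_transform \<nu> (pCons 0 Q) t"
proof -
  define L where "L = (\<lambda>s. LBINT x:{0<..}. (poly Q x * rho \<nu> x) * exp (- (x * s)))"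
  define M where "M = (LBINT x:{0<..}. x * (poly Q x * rho \<nu> x) * exp (- (x * (1 / t))))"
  have "(L has_real_derivative - M) (at (1 / t))"
    unfolding L_def M_def
    using poly_rho_integrable[OF assms(1), of Q] poly_rho_integrable[OF assms(1), of "pCons 0 Q"] assms(2)
    by (intro has_field_derivative_Laplace) (simp_all add: mult_ac)
  moreover have "((\<lambda>s. 1 / s) has_real_derivative - (1 / t\<^sup>2)) (at t)"
    using assms(2) by (auto intro!: derivative_eq_intros simp: power2_eq_square)
  ultimately have "((\<lambda>s. L (1 / s)) has_real_derivative - M * - (1 / t\<^sup>2)) (at t)"
    by (rule DERIV_chain2)
  then have "((\<lambda>s. c * L (1 / s)) has_real_derivative c * (- M * - (1 / t\<^sup>2))) (at t)"
    by (rule DERIV_cmult)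
  then have "((\<lambda>s. s * f s) has_real_derivative c * (- M * - (1 / t\<^sup>2))) (at t)"
  proof (rule has_field_derivative_transform_within_open)
    show "open {0::real<..}" "t \<in> {0<..}" using assms(2) by auto
    show "c * L (1 / s) = s * f s" if "s \<in> {0<..}" for s
      using that f[of s] by (simp add: rho_transform_def L_def)
  qed
  then have "deriv (\<lambda>s. s * f s) t = c * M / t\<^sup>2"
    by (simp add: DERIV_imp_deriv)
  then show ?thesis
    using assms(2) by (simp add: theta_def rho_transform_def M_def power2_eq_square mult_ac)
qed

lemma theta_funpow_rho_transform:
  assumes "\<nu> > -1" "t > 0"
    and f: "\<And>s. s > 0 \<Longrightarrow> f s = c * rho_transform \<nu> Q s"
  shows "(theta ^^ k) f t = c * rho_transform \<nu> (monom 1 k * Q) t"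
  using assms(2)
\<comment> \<open>\<open>t\<close> is generalised because differentiating at one point uses the
  induction hypothesis at all positive points.\<close>
proof (induction k arbitrary: t)
  case 0
  then show ?case by (simp add: f)
next
  case (Suc k)
  have "theta ((theta ^^ k) f) t = c * rho_transform \<nu> (pCons 0 (monom 1 k * Q)) t"
    by (rule theta_rho_transform[OF assms(1) Suc.prems Suc.IH])
  then show ?case by (simp add: monom_Suc)
qed

text \<open>Linearity in the density turns the sum over powers of \<open>theta\<close> into
  multiplication by \<open>P\<close>. Hypothesis and conclusion have the same shape, so that the
  lemma can be applied again to its own result and composition of operators becomes a product of
  polynomials.\<close>

lemma poly_theta_rho_transform:
  assumes "\<nu> > -1" "t > 0"
    and f: "\<And>s. s > 0 \<Longrightarrow> f s = c * rho_transform \<nu> Q s"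
  shows "poly_theta P f t = c * rho_transform \<nu> (P * Q) t"
proof -
  have i: "set_integrable lborel {0<..}
      (\<lambda>x. poly (monom 1 k * Q) x * rho \<nu> x * exp (- (x * (1 / t))))" for k
    using assms(2) by (intro set_integrable_mult_exp poly_rho_integrable[OF assms(1)]) auto
  have s: "poly (P * Q) x * rho \<nu> x * exp (- (x * (1 / t))) = (\<Sum>k\<le>degree P. coeff P k *
      (poly (monom 1 k * Q) x * rho \<nu> x * exp (- (x * (1 / t)))))" for x
    by (simp add: poly_altdef[of P] poly_monom sum_distrib_right[symmetric] mult.assoc[symmetric])
  have "rho_transform \<nu> (P * Q) t = (LBINT x:{0<..}. (\<Sum>k\<le>degree P. coeff P k *
      (poly (monom 1 k * Q) x * rho \<nu> x * exp (- (x * (1 / t)))))) / t"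
    unfolding rho_transform_def s ..
  also have "\<dots> = (\<Sum>k\<le>degree P. coeff P k * rho_transform \<nu> (monom 1 k * Q) t)"
    unfolding rho_transform_def
    by (subst set_integral_sum(2)[OF set_integrable_mult_right[OF i]])
      (simp only: set_integral_mult_right sum_divide_distrib times_divide_eq_right)
  finally have "c * rho_transform \<nu> (P * Q) t
      = (\<Sum>k\<le>degree P. coeff P k * (c * rho_transform \<nu> (monom 1 k * Q) t))"
    by (simp add: sum_distrib_left mult.left_commute)
  moreover have "(theta ^^ k) f t = c * rho_transform \<nu> (monom 1 k * Q) t" for k
    by (rule theta_funpow_rho_transform[OF assms(1,2) f])
  ultimately show ?thesis
    by (simp add: poly_theta_def)
qed

section \<open>The function \<open>omega\<close> as the transform of the constant polynomial
  1\<close>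

text \<open>Insert the integral form of \<open>rho\<close> and integrate over x first: this gives
  1/(1/t + 1/u) = t u/(t + u), whose factor u raises u^(\<nu>-1) to u^\<nu>.\<close>

lemma rho_transform_1:
  fixes \<nu> t :: real
  assumes "\<nu> > -1" "t > 0"
  shows "rho_transform \<nu> 1 t = (LBINT u:{0<..}. u powr \<nu> * exp (- u) / (t + u))"
proof -
  define f where "f = (\<lambda>u x::real. (u powr (\<nu> - 1) * exp (- u)) * exp (- ((1 / t + 1 / u) * x)))"
  have [measurable]: "case_prod f \<in> borel_measurable (lborel \<Otimes>\<^sub>M lborel)"
    unfolding f_def by measurable
  have p: "1 / t + 1 / u > 0" if "u > 0" for u
    using that assms by (simp add: add_pos_pos)
  have inner: "set_integrable lborel {0<..} (f u)" if "u \<in> {0<..}" for u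
    using that p unfolding f_def by (intro set_integrable_mult_right exp_set_integral(1)) auto
  have v: "(LBINT x:{0<..}. f u x) = t * (u powr \<nu> * exp (- u) / (t + u))" if "u > 0" for u
  proof -
    have "(LBINT x:{0<..}. f u x) = u powr (\<nu> - 1) * exp (- u) / (1 / t + 1 / u)"
      unfolding f_def set_integral_mult_right exp_set_integral(2)[OF p[OF that]] by simp
    then show ?thesis
      using that assms by (simp add: powr_diff field_simps)
  qed
  \<comment> \<open>Since t/(t + u) \<le> 1, the integrand of \<open>Gamma (\<nu> + 1)\<close> is a
    majorant.\<close>
  have "set_integrable lborel {0<..} (\<lambda>u. t * (u powr \<nu> * exp (- u) / (t + u)))"
  proof (rule set_integrable_bound)
    show "set_integrable lborel {0<..} (\<lambda>u. u powr (\<nu> + 1 - 1) * exp (- (1 * u)))"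
      using assms by (intro Gamma_set_integral) auto
    show "set_borel_measurable lborel {0<..} (\<lambda>u. t * (u powr \<nu> * exp (- u) / (t + u)))"
      unfolding set_borel_measurable_def by measurable
    show "AE u in lborel. u \<in> {0<..} \<longrightarrow> norm (t * (u powr \<nu> * exp (- u) / (t + u)))
            \<le> norm (u powr (\<nu> + 1 - 1) * exp (- (1 * u)))"
      using assms by (auto simp: divide_simps abs_mult mult_left_mono)
  qed
  moreover have "\<bar>f u x\<bar> = f u x" for u x by (simp add: f_def)
  ultimately have outer: "set_integrable lborel {0<..} (\<lambda>u. LBINT x:{0<..}. \<bar>f u x\<bar>)"
    by (subst set_integrable_cong[OF refl refl]) (auto simp: v)
  have r: "(LBINT u:{0<..}. f u x) = rho \<nu> x * exp (- (x * (1 / t)))" if "x > 0" for x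
  proof -
    have "f u x = exp (- (x * (1 / t))) * (u powr (\<nu> - 1) * exp (- u - x / u))" for u
      by (simp add: f_def algebra_simps flip: exp_add)
    then show ?thesis using that by (simp add: rho_integral_form(2))
  qed
  have "t * rho_transform \<nu> 1 t = (LBINT x:{0<..}. (LBINT u:{0<..}. f u x))"
    using assms(2) unfolding rho_transform_def
    by (auto intro!: set_lebesgue_integral_cong simp: r)
  also have "\<dots> = (LBINT u:{0<..}. (LBINT x:{0<..}. f u x))"
    by (rule set_Fubini_real(2)[OF _ _ _ inner outer]) auto
  also have "\<dots> = (LBINT u:{0<..}. t * (u powr \<nu> * exp (- u) / (t + u)))"
    by (rule set_lebesgue_integral_cong) (auto simp: v)
  also have "\<dots> = t * (LBINT u:{0<..}. u powr \<nu> * exp (- u) / (t + u))"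
    by (rule set_integral_mult_right)
  finally show ?thesis using assms(2) by simp
qed

text \<open>In the incomplete Gamma integral, \<open>Gamma (1 + \<nu>)\<close> times v^(-\<nu>-1) is
  the integral of u^\<nu> exp(-uv) over u. Exchanging the order leaves an elementary exponential
  integral over v > t, and scaling u by t gives the stated form.\<close>

lemma omega_integral:
  fixes \<nu> t :: real
  assumes "\<nu> > -1" "t > 0"
  shows "Gamma (1 + \<nu>) * omega \<nu> t = (LBINT u:{0<..}. u powr \<nu> * exp (- u) / (t + u))"
proof -
  define f where "f = (\<lambda>u v::real. u powr \<nu> * exp (- ((1 + u) * v)))"
  have [measurable]: "case_prod f \<in> borel_measurable (lborel \<Otimes>\<^sub>M lborel)"
    unfolding f_def by measurable
  have inner: "set_integrable lborel {t<..} (f u)" if "u \<in> {0<..}" for u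
    using that unfolding f_def by (intro set_integrable_mult_right exp_set_integral(1)) auto
  have v: "(LBINT v:{t<..}. f u v) = u powr \<nu> * exp (- ((1 + u) * t)) / (1 + u)" if "u > 0" for u
    using that exp_set_integral(2)[of "1 + u" t] by (simp add: f_def)
  have "set_integrable lborel {0<..} (\<lambda>u. u powr \<nu> * exp (- ((1 + u) * t)) / (1 + u))"
  proof (rule set_integrable_bound)
    show "set_integrable lborel {0<..} (\<lambda>u. u powr (\<nu> + 1 - 1) * exp (- (t * u)))"
      using assms by (intro Gamma_set_integral) auto
    show "set_borel_measurable lborel {0<..} (\<lambda>u. u powr \<nu> * exp (- ((1 + u) * t)) / (1 + u))"
      unfolding set_borel_measurable_def by measurable
    \<comment> \<open>The factors exp(-t) and 1/(1 + u), both at most 1, are dropped; a Gamma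
      integrand of rate t remains.\<close>
    have "u powr \<nu> * exp (- ((1 + u) * t)) / (1 + u) \<le> u powr \<nu> * exp (- (t * u)) / 1" if "u > 0" for u
      using that assms by (intro frac_le mult_left_mono) (auto simp: algebra_simps)
    then show "AE u in lborel. u \<in> {0<..} \<longrightarrow> norm (u powr \<nu> * exp (- ((1 + u) * t)) / (1 + u))
            \<le> norm (u powr (\<nu> + 1 - 1) * exp (- (t * u)))"
      by auto
  qed
  moreover have "\<bar>f u x\<bar> = f u x" for u x by (simp add: f_def)
  ultimately have outer: "set_integrable lborel {0<..} (\<lambda>u. LBINT v:{t<..}. \<bar>f u v\<bar>)"
    by (subst set_integrable_cong[OF refl refl]) (auto simp: v)
  have r: "(LBINT u:{0<..}. f u x) = Gamma (1 + \<nu>) * (exp (- x) * x powr (- \<nu> - 1))" if "x > t" for x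
  proof -
    have "f u x = exp (- x) * (u powr (\<nu> + 1 - 1) * exp (- (x * u)))" for u
      by (simp add: f_def algebra_simps flip: exp_add)
    then have "(LBINT u:{0<..}. f u x) = exp (- x) * (Gamma (\<nu> + 1) / x powr (\<nu> + 1))"
      using that assms by (simp only: set_integral_mult_right Gamma_set_integral(2))
    then show ?thesis
      using that assms by (simp add: powr_minus powr_diff powr_add field_simps)
  qed
  have "Gamma (1 + \<nu>) * upper_Gamma (- \<nu>) t = (LBINT v:{t<..}. (LBINT u:{0<..}. f u v))"
    unfolding upper_Gamma_def set_integral_mult_right[symmetric]
    by (rule set_lebesgue_integral_cong) (auto simp: r)
  also have "\<dots> = (LBINT u:{0<..}. (LBINT v:{t<..}. f u v))"
    by (rule set_Fubini_real(2)[OF _ _ _ inner outer]) auto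
  also have "\<dots> = (LBINT u:{0<..}. u powr \<nu> * exp (- ((1 + u) * t)) / (1 + u))"
    by (rule set_lebesgue_integral_cong) (auto simp: v)
  finally have "Gamma (1 + \<nu>) * omega \<nu> t
      = (LBINT u:{0<..}. t powr \<nu> * exp t * (u powr \<nu> * exp (- ((1 + u) * t)) / (1 + u)))"
    unfolding set_integral_mult_right by (simp add: omega_def mult_ac)
  \<comment> \<open>The integrand is brought into the form t g(tu), ready for the substitution u ->
    t u.\<close>
  also have "\<dots> = (LBINT u:{0<..}. t * ((t * u) powr \<nu> * exp (- (t * u)) / (t + t * u)))"
  proof (rule set_lebesgue_integral_cong, simp, intro allI impI)
    fix u :: real assume u: "u \<in> {0<..}"
    have "exp t * exp (- ((1 + u) * t)) = exp (- (t * u))"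
      by (simp add: algebra_simps flip: exp_add)
    moreover have "t + t * u = t * (1 + u)" by (simp add: algebra_simps)
    ultimately show "t powr \<nu> * exp t * (u powr \<nu> * exp (- ((1 + u) * t)) / (1 + u))
        = t * ((t * u) powr \<nu> * exp (- (t * u)) / (t + t * u))"
      using u assms by (simp add: powr_mult mult.assoc mult.left_commute[of "exp t"])
  qed
  also have "\<dots> = t * (LBINT u:{0<..}. (t * u) powr \<nu> * exp (- (t * u)) / (t + t * u))"
    by (rule set_integral_mult_right)
  also have "\<dots> = (LBINT u:{0<..}. u powr \<nu> * exp (- u) / (t + u))"
    by (rule set_integral_Ioi_scale(1)[OF assms(2), symmetric])
  finally show ?thesis .
qed

section \<open>Pairing with t^\<nu> exp(-t) and the orthogonality relation\<close>

text \<open>The weight t^\<nu> exp(-t) times the eigenfunction exp(-x/t)/t is the integrand of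
  \<open>rho \<nu> x\<close>, so integrating over t first produces the second factor of
  \<open>rho\<close>.\<close>

lemma rho_transform_pairing:
  fixes \<nu> :: real
  assumes R: "set_integrable lborel {0<..} (\<lambda>x. poly R x * (rho \<nu> x)\<^sup>2)"
  shows "set_integrable lborel {0<..} (\<lambda>t. t powr \<nu> * exp (- t) * rho_transform \<nu> R t)"
    and "(LBINT t:{0<..}. t powr \<nu> * exp (- t) * rho_transform \<nu> R t)
          = (LBINT x:{0<..}. poly R x * (rho \<nu> x)\<^sup>2)"
proof -
  define f where "f = (\<lambda>x t::real. (poly R x * rho \<nu> x) * (t powr (\<nu> - 1) * exp (- t - x / t)))"
  have [measurable]: "case_prod f \<in> borel_measurable (lborel \<Otimes>\<^sub>M lborel)"
    unfolding f_def by measurable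
  have inner: "set_integrable lborel {0<..} (f x)" if "x \<in> {0<..}" for x
    using that unfolding f_def by (intro set_integrable_mult_right rho_integral_form(1)) auto
  \<comment> \<open>The kernel in t is nonnegative and so is \<open>rho\<close>, hence absolute
    integrability of the double integral is exactly the hypothesis \<open>R\<close>.\<close>
  have "(LBINT t:{0<..}. \<bar>f x t\<bar>) = \<bar>poly R x * (rho \<nu> x)\<^sup>2\<bar>" if "x > 0" for x
    using that rho_nonneg[OF that, of \<nu>]
    by (simp add: f_def abs_mult power2_eq_square flip: rho_integral_form(2))
  then have outer: "set_integrable lborel {0<..} (\<lambda>x. LBINT t:{0<..}. \<bar>f x t\<bar>)"
    using set_integrable_abs[OF R] by (subst set_integrable_cong[OF refl refl]) auto
  have e: "(LBINT x:{0<..}. f x t) = t powr \<nu> * exp (- t) * rho_transform \<nu> R t" if "t > 0" for t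
  proof -
    have "f x t = t powr \<nu> * exp (- t) / t * (poly R x * rho \<nu> x * exp (- (x * (1 / t))))" for x
      using that by (simp add: f_def powr_diff exp_diff exp_minus field_simps)
    then show ?thesis by (simp add: rho_transform_def)
  qed
  have "set_integrable lborel {0<..} (\<lambda>t. LBINT x:{0<..}. f x t)"
    by (rule set_Fubini_real(1)[OF _ _ _ inner outer]) auto
  then show "set_integrable lborel {0<..} (\<lambda>t. t powr \<nu> * exp (- t) * rho_transform \<nu> R t)"
    by (subst (asm) set_integrable_cong[OF refl refl e]) auto
  have "(LBINT t:{0<..}. t powr \<nu> * exp (- t) * rho_transform \<nu> R t) = (LBINT t:{0<..}. (LBINT x:{0<..}. f x t))"
    by (rule set_lebesgue_integral_cong) (auto simp: e)
  also have "\<dots> = (LBINT x:{0<..}. (LBINT t:{0<..}. f x t))"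
    by (rule set_Fubini_real(2)[OF _ _ _ inner outer]) auto
  also have "\<dots> = (LBINT x:{0<..}. poly R x * (rho \<nu> x)\<^sup>2)"
    by (rule set_lebesgue_integral_cong)
      (auto simp: f_def power2_eq_square simp flip: rho_integral_form(2))
  finally show "(LBINT t:{0<..}. t powr \<nu> * exp (- t) * rho_transform \<nu> R t)
      = (LBINT x:{0<..}. poly R x * (rho \<nu> x)\<^sup>2)" .
qed

theorem theorem1:
  fixes \<nu> :: real and P :: "nat \<Rightarrow> real poly"
  assumes "\<nu> > -1/2"
    and "\<And>n. degree (P n) = n"
    and "\<And>m n. (LBINT x:{0<..}. poly (P m) x * poly (P n) x * (rho \<nu> x)\<^sup>2)
            = (if n = m then 1 else 0)"
  shows "\<forall>n m.
     set_integrable lborel {0<..}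
       (\<lambda>t. t powr \<nu> * exp (- t) * poly_theta (P n) (poly_theta (P m) (omega \<nu>)) t) \<and>
     (LBINT t:{0<..}. t powr \<nu> * exp (- t) * poly_theta (P n) (poly_theta (P m) (omega \<nu>)) t)
       = (if n = m then 1 else 0) / Gamma (1 + \<nu>)"
proof (intro allI)
  fix n m
  have \<nu>: "\<nu> > -1" using assms(1) by simp
  then have G: "Gamma (1 + \<nu>) > 0" by simp
  define w where "w = (\<lambda>t. t powr \<nu> * exp (- t) * rho_transform \<nu> (P n * P m) t)"
  \<comment> \<open>A non-integrable function has Lebesgue integral 0, so the normalisation forces integrability.\<close>
  have sq: "set_integrable lborel {0<..} (\<lambda>x. poly (P k) x * poly (P k) x * (rho \<nu> x)\<^sup>2)" for k
    using assms(3)[of k k] not_integrable_integral_eq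
    unfolding set_integrable_def set_lebesgue_integral_def by fastforce
  have R: "set_integrable lborel {0<..} (\<lambda>x. poly (P n * P m) x * (rho \<nu> x)\<^sup>2)"
  \<comment> \<open>The bound |ab| \<le> a^2 + b^2 passes from the two diagonal integrands to the
    mixed one.\<close>
  proof (rule set_integrable_bound[OF set_integral_add(1)[OF sq[of n] sq[of m]]])
    show "set_borel_measurable lborel {0<..} (\<lambda>x. poly (P n * P m) x * (rho \<nu> x)\<^sup>2)"
      unfolding set_borel_measurable_def by measurable
    have "\<bar>a * b\<bar> \<le> a * a + b * b" for a b :: real
    proof -
      have "2 * (\<bar>a\<bar> * \<bar>b\<bar>) \<le> a * a + b * b"
        using sum_squares_bound[of "\<bar>a\<bar>" "\<bar>b\<bar>"] by (simp add: power2_eq_square)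
      moreover have "0 \<le> \<bar>a\<bar> * \<bar>b\<bar>" by simp
      ultimately show ?thesis unfolding abs_mult by linarith
    qed
    then have "\<bar>a * b\<bar> * r\<^sup>2 \<le> (a * a + b * b) * r\<^sup>2" for a b r :: real
      by (rule mult_right_mono) simp
    then show "AE x in lborel. x \<in> {0<..} \<longrightarrow> norm (poly (P n * P m) x * (rho \<nu> x)\<^sup>2)
        \<le> norm (poly (P n) x * poly (P n) x * (rho \<nu> x)\<^sup>2 + poly (P m) x * poly (P m) x * (rho \<nu> x)\<^sup>2)"
      by (auto simp: abs_mult distrib_right[symmetric])
  qed
  \<comment> \<open>Starting from Q = 1, each application of a polynomial in \<open>theta\<close>
    multiplies \<open>Q\<close>: first by \<open>P m\<close>, then by \<open>P n\<close>. All three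
    identities hold on t > 0, which is all that the next one requires.\<close>
  have 0: "omega \<nu> t = 1 / Gamma (1 + \<nu>) * rho_transform \<nu> 1 t" if "t > 0" for t
    using omega_integral[OF \<nu> that] rho_transform_1[OF \<nu> that] G by (simp add: field_simps)
  have 1: "poly_theta (P m) (omega \<nu>) t = 1 / Gamma (1 + \<nu>) * rho_transform \<nu> (P m) t" if "t > 0" for t
    using poly_theta_rho_transform[OF \<nu> that 0] by simp
  have 2: "poly_theta (P n) (poly_theta (P m) (omega \<nu>)) t
      = 1 / Gamma (1 + \<nu>) * rho_transform \<nu> (P n * P m) t" if "t > 0" for t
    by (rule poly_theta_rho_transform[OF \<nu> that 1])
  have e: "t powr \<nu> * exp (- t) * poly_theta (P n) (poly_theta (P m) (omega \<nu>)) t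
      = 1 / Gamma (1 + \<nu>) * w t" if "t \<in> {0<..}" for t
    using that by (simp add: 2 w_def)
  have "set_integrable lborel {0<..} (\<lambda>t. 1 / Gamma (1 + \<nu>) * w t)"
    unfolding w_def by (intro set_integrable_mult_right rho_transform_pairing(1) R)
  then have I: "set_integrable lborel {0<..}
      (\<lambda>t. t powr \<nu> * exp (- t) * poly_theta (P n) (poly_theta (P m) (omega \<nu>)) t)"
    by (subst set_integrable_cong[OF refl refl e]) auto
  have "(LBINT t:{0<..}. t powr \<nu> * exp (- t) * poly_theta (P n) (poly_theta (P m) (omega \<nu>)) t)
      = (LBINT t:{0<..}. 1 / Gamma (1 + \<nu>) * w t)"
    by (rule set_lebesgue_integral_cong) (auto simp: e)
  also have "\<dots> = 1 / Gamma (1 + \<nu>) * (LBINT x:{0<..}. poly (P n) x * poly (P m) x * (rho \<nu> x)\<^sup>2)"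
    unfolding set_integral_mult_right w_def rho_transform_pairing(2)[OF R] by simp
  finally show "set_integrable lborel {0<..}
       (\<lambda>t. t powr \<nu> * exp (- t) * poly_theta (P n) (poly_theta (P m) (omega \<nu>)) t) \<and>
     (LBINT t:{0<..}. t powr \<nu> * exp (- t) * poly_theta (P n) (poly_theta (P m) (omega \<nu>)) t)
       = (if n = m then 1 else 0) / Gamma (1 + \<nu>)"
    using I by (simp add: assms(3))
qed

end
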